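(* Let $k\ge 0$ and $n\ge 1$ be integers, let $\mathsf{V}=\mathsf{V}(0)\oplus\mathsf{V}(1)$ be the $(n+1)$-dimensional $\mathsf{O}_n(\mathbb{C})$-module with basis $v_0,v_1,\dots,v_n$ described in the context, and let $\rho_{\mathsf{V}^{\otimes k}}:\mathsf{O}_n(\mathbb{C})\to\operatorname{End}(\mathsf{V}^{\otimes k})$ be the representation of $\mathsf{O}_n(\mathbb{C})$ on $\mathsf{V}^{\otimes k}$. Let $\pi_k:\mathsf{RB}_k(n+1)\to\operatorname{End}(\mathsf{V}^{\otimes k})$ be the representation of the rook-Brauer algebra on tensor space. Then $\pi_k(\mathsf{RB}_k(n+1))$ and $\rho_{\mathsf{V}^{\otimes k}}(\mathsf{O}_n(\mathbb{C}))$ commute in $\operatorname{End}(\mathsf{V}^{\otimes k})$. Thus $$\pi_k(\mathsf{RB}_k(n+1))\subseteq\operatorname{End}_{\mathsf{O}_n(\mathbb{C})}(\mathsf{V}^{\otimes k})\quad\text{and}\quad\rho_{\mathsf{V}^{\otimes k}}(\mathsf{O}_n(\mathbb{C}))\subseteq\operatorname{End}_{\mathsf{RB}_k(n+1)}(\mathsf{V}^{\otimes k}).$$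
   Context: $\mathsf{O}_n(\mathbb{C})=\{g\in\mathsf{GL}_n(\mathbb{C}) : gg^t=I\}$. $\mathsf{V}(0)=\mathbb{C}v_0$ is the trivial module and $\mathsf{V}(1)=\mathbb{C}^n$, with basis $v_1,\dots,v_n$, is the defining module: for $g=(g_{ij})$, $g v_0=v_0$ and $g v_j=\sum_{i=1}^n g_{ij}v_i$ for $1\le j\le n$. The group acts diagonally on $\mathsf{V}^{\otimes k}$: $g(v_{i_1}\otimes\cdots\otimes v_{i_k})=gv_{i_1}\otimes\cdots\otimes gv_{i_k}$. $\mathsf{V}^{\otimes 0}$ is the trivial module. A rook-Brauer $k$-diagram is a graph on two rows of $k$ vertices each (a top row and a bottom row, each numbered $1,\dots,k$ from left to right) in which each vertex is joined by an edge to at most one other vertex. The set of these diagrams is $\mathcal{RB}_k$. For $x\in\mathbb{C}$, the rook-Brauer algebra $\mathsf{RB}_k(x)$ is the $\mathbb{C}$-vector space with basis $\mathcal{RB}_k$ (with $\mathsf{RB}_0(x)=\mathbb{C}1$) and bilinear multiplication determined as follows. For diagrams $d_1,d_2$, place $d_1$ above $d_2$ and identify the bottom vertices of $d_1$ with the corresponding top vertices of $d_2$. Then $d_1d_2=x^{\kappa(d_1,d_2)}d_3$, where $\kappa(d_1,d_2)$ is the number of closed loops formed entirely in the middle row, and $d_3$ is the rook-Brauer diagram on the top row of $d_1$ and the bottom row of $d_2$ in which two vertices are joined by an edge if and only if they lie in the same connected component of the stacked graph. (Components contained in the middle row that are not closed loops are discarded with factor $1$.) The representation $\pi_k$ is the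 linear map given on diagrams by $$\pi_k(d)(v_{i_1}\otimes\cdots\otimes v_{i_k})=\sum_{j_1,\dots,j_k\in\{0,\dots,n\}}(d)_{i_1,\dots,i_k}^{j_1,\dots,j_k}\;v_{j_1}\otimes\cdots\otimes v_{j_k}.$$ Here one labels the bottom vertices of $d$ from left to right by $i_1,\dots,i_k$ and the top vertices by $j_1,\dots,j_k$, and $(d)_{i_1,\dots,i_k}^{j_1,\dots,j_k}$ is the product over all connected components of $d$ of the following weights: an isolated vertex labeled $a$ has weight $\delta_{a,0}$, and an edge joining vertices labeled $a$ and $b$ has weight $\delta_{a,b}$. *)

theory Defs
  imports
    "HOL-Algebra.Module"
    "Jordan_Normal_Form.Matrix"
    "HOL-Library.FuncSet"
begin

definition orthogonal_group :: "nat \<Rightarrow> complex mat set" where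
  "orthogonal_group n =
     {g \<in> carrier_mat n n. invertible_mat g \<and> g * transpose_mat g = 1\<^sub>m n}"

text \<open>A vector of V is its coordinate function with respect to $v_0, \dots, v_n$.\<close>

definition basis_vec :: "nat \<Rightarrow> nat \<Rightarrow> complex" where
  "basis_vec j = (\<lambda>r. if r = j then 1 else 0)"

text \<open>The vector $g v_j$.  The matrices of the library are indexed from 0, so that the entry
  $g_{ij}$ with $1 \le i, j \le n$ is the one at position $(i-1, j-1)$.\<close>

definition act_basis :: "nat \<Rightarrow> complex mat \<Rightarrow> nat \<Rightarrow> nat \<Rightarrow> complex" where
  "act_basis n g j =
     (if j = 0 then basis_vec 0
      else (\<lambda>r. \<Sum>i = 1..n. g $$ (i - 1, j - 1) * basis_vec i r))"

text \<open>A tensor in the k-th tensor power of V is its coordinate function with respect to the basis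
  $v_{i_1} \otimes \cdots \otimes v_{i_k}$, which is indexed by the words $[i_1, \dots, i_k]$
  over $\{0, \dots, n\}$.  For $k = 0$ the empty word is the only index.\<close>

definition words :: "nat \<Rightarrow> nat \<Rightarrow> nat list set" where
  "words n k = {w. length w = k \<and> set w \<subseteq> {0..n}}"

definition tensor_space :: "nat \<Rightarrow> nat \<Rightarrow> (nat list \<Rightarrow> complex) set" where
  "tensor_space n k = {t. \<forall>w. w \<notin> words n k \<longrightarrow> t w = 0}"

text \<open>The pure tensor $u_1 \otimes \cdots \otimes u_k$ of a list of vectors of V.\<close>

definition pure_tensor :: "(nat \<Rightarrow> complex) list \<Rightarrow> nat list \<Rightarrow> complex" where
  "pure_tensor us = (\<lambda>w. if length w = length us
     then \<Prod>m<length us. (us ! m) (w ! m) else 0)"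

text \<open>Endomorphisms are extensional functions (undefined outside the tensor space), so that
  equality of functions is equality of endomorphisms; their product is \<^const>\<open>compose\<close>.\<close>

definition tensor_End ::
    "nat \<Rightarrow> nat \<Rightarrow> ((nat list \<Rightarrow> complex) \<Rightarrow> (nat list \<Rightarrow> complex)) set" where
  "tensor_End n k = {f \<in> tensor_space n k \<rightarrow>\<^sub>E tensor_space n k.
     (\<forall>s\<in>tensor_space n k. \<forall>t\<in>tensor_space n k. f (\<lambda>w. s w + t w) = (\<lambda>w. f s w + f t w)) \<and>
     (\<forall>c. \<forall>t\<in>tensor_space n k. f (\<lambda>w. c * t w) = (\<lambda>w. c * f t w))}"

text \<open>The linear extension of
  $g(v_{i_1} \otimes \cdots \otimes v_{i_k}) = g v_{i_1} \otimes \cdots \otimes g v_{i_k}$.\<close>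

definition tensor_rho ::
    "nat \<Rightarrow> nat \<Rightarrow> complex mat \<Rightarrow> (nat list \<Rightarrow> complex) \<Rightarrow> (nat list \<Rightarrow> complex)" where
  "tensor_rho n k g = (\<lambda>t\<in>tensor_space n k.
     (\<lambda>w. \<Sum>i\<in>words n k. t i * pure_tensor (map (act_basis n g) i) w))"

text \<open>The vertices of each row are numbered from 0 to $k - 1$, matching the positions of a word of
  length $k$.  A diagram is identified with its set of edges, an edge being a two-element set.\<close>

datatype vertex = Top nat | Bot nat

definition vertices :: "nat \<Rightarrow> vertex set" where
  "vertices k = Top ` {..<k} \<union> Bot ` {..<k}"

definition rb_diagrams :: "nat \<Rightarrow> vertex set set set" where
  "rb_diagrams k = {d.
     (\<forall>e\<in>d. \<exists>u\<in>vertices k. \<exists>v\<in>vertices k. u \<noteq> v \<and> e = {u, v}) \<and>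
     (\<forall>u\<in>vertices k. \<exists>\<^sub>\<le>\<^sub>1v. {u, v} \<in> d)}"

definition component :: "'v set set \<Rightarrow> 'v \<Rightarrow> 'v set" where
  "component E u = {v. (u, v) \<in> {(a, b). {a, b} \<in> E}\<^sup>*}"

text \<open>The three rows of vertices that result from placing one diagram above another one.\<close>

datatype stack_vertex = Upper nat | Middle nat | Lower nat

fun in_upper_diagram :: "vertex \<Rightarrow> stack_vertex" where
  "in_upper_diagram (Top i) = Upper i"
| "in_upper_diagram (Bot i) = Middle i"

fun in_lower_diagram :: "vertex \<Rightarrow> stack_vertex" where
  "in_lower_diagram (Top i) = Middle i"
| "in_lower_diagram (Bot i) = Lower i"

fun outer :: "vertex \<Rightarrow> stack_vertex" where
  "outer (Top i) = Upper i"
| "outer (Bot i) = Lower i"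

definition stack :: "vertex set set \<Rightarrow> vertex set set \<Rightarrow> stack_vertex set set" where
  "stack d1 d2 = (image in_upper_diagram) ` d1 \<union> (image in_lower_diagram) ` d2"

text \<open>The diagram $d_3$ in $d_1 d_2 = x^{\kappa(d_1, d_2)} d_3$.\<close>

definition rb_compose :: "nat \<Rightarrow> vertex set set \<Rightarrow> vertex set set \<Rightarrow> vertex set set" where
  "rb_compose k d1 d2 = {{u, v} | u v. u \<in> vertices k \<and> v \<in> vertices k \<and> u \<noteq> v \<and>
     outer v \<in> component (stack d1 d2) (outer u)}"

text \<open>The number $\kappa(d_1, d_2)$.  A component inside the middle row is a closed loop iff each of
  its vertices meets an edge of $d_1$ and an edge of $d_2$.  The two edges are looked up in the
  two diagrams separately because they may be parallel, in which case they are one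
  element of \<^term>\<open>stack d1 d2\<close>.\<close>

definition rb_loops :: "nat \<Rightarrow> vertex set set \<Rightarrow> vertex set set \<Rightarrow> nat" where
  "rb_loops k d1 d2 = card {C. \<exists>i<k. C = component (stack d1 d2) (Middle i) \<and>
     C \<subseteq> Middle ` {..<k} \<and>
     (\<forall>m. Middle m \<in> C \<longrightarrow> (\<exists>e\<in>d1. Bot m \<in> e) \<and> (\<exists>e\<in>d2. Top m \<in> e))}"

definition rb_identity :: "nat \<Rightarrow> vertex set set" where
  "rb_identity k = {{Top i, Bot i} | i. i < k}"

text \<open>An element of the algebra is its coordinate function with respect to the basis of diagrams.\<close>

definition RB :: "nat \<Rightarrow> complex \<Rightarrow> (complex, vertex set set \<Rightarrow> complex) module" where
  "RB k x = \<lparr>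
     carrier = {a. \<forall>d. d \<notin> rb_diagrams k \<longrightarrow> a d = 0},
     monoid.mult = (\<lambda>a b d. \<Sum>d1\<in>rb_diagrams k. \<Sum>d2\<in>rb_diagrams k.
       a d1 * b d2 * (if d = rb_compose k d1 d2 then x ^ rb_loops k d1 d2 else 0)),
     one = (\<lambda>d. if d = rb_identity k then 1 else 0),
     zero = (\<lambda>d. 0),
     add = (\<lambda>a b d. a d + b d),
     smult = (\<lambda>c a d. c * a d)\<rparr>"

text \<open>The bottom vertices are labelled by \<open>i\<close> and the top vertices by \<open>j\<close>.\<close>

fun vertex_label :: "nat list \<Rightarrow> nat list \<Rightarrow> vertex \<Rightarrow> nat" where
  "vertex_label i j (Top m) = j ! m"
| "vertex_label i j (Bot m) = i ! m"

text \<open>The coefficient $(d)_{i_1, \dots, i_k}^{j_1, \dots, j_k}$.  The components of a diagram are its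
  edges and its isolated vertices.\<close>

definition rb_weight :: "nat \<Rightarrow> vertex set set \<Rightarrow> nat list \<Rightarrow> nat list \<Rightarrow> complex" where
  "rb_weight k d i j =
     (\<Prod>v\<in>{v \<in> vertices k. \<forall>e\<in>d. v \<notin> e}. if vertex_label i j v = 0 then 1 else 0) *
     (\<Prod>e\<in>d. if \<forall>u\<in>e. \<forall>v\<in>e. vertex_label i j u = vertex_label i j v then 1 else 0)"

definition rb_pi :: "nat \<Rightarrow> nat \<Rightarrow> (vertex set set \<Rightarrow> complex) \<Rightarrow>
    (nat list \<Rightarrow> complex) \<Rightarrow> (nat list \<Rightarrow> complex)" where
  "rb_pi n k a = (\<lambda>t\<in>tensor_space n k.
     (\<lambda>w. \<Sum>d\<in>rb_diagrams k. a d * (\<Sum>i\<in>words n k. t i *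
       (\<Sum>j\<in>words n k. rb_weight k d i j * pure_tensor (map basis_vec j) w))))"

definition End_O ::
    "nat \<Rightarrow> nat \<Rightarrow> ((nat list \<Rightarrow> complex) \<Rightarrow> (nat list \<Rightarrow> complex)) set" where
  "End_O n k = {f \<in> tensor_End n k. \<forall>g\<in>orthogonal_group n.
     compose (tensor_space n k) f (tensor_rho n k g) =
     compose (tensor_space n k) (tensor_rho n k g) f}"

definition End_RB ::
    "nat \<Rightarrow> nat \<Rightarrow> ((nat list \<Rightarrow> complex) \<Rightarrow> (nat list \<Rightarrow> complex)) set" where
  "End_RB n k = {f \<in> tensor_End n k. \<forall>a\<in>carrier (RB k (of_nat (n + 1))).
     compose (tensor_space n k) f (rb_pi n k a) =
     compose (tensor_space n k) (rb_pi n k a) f}"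

end

(* Weight a labelling f of the 2k vertices by the coefficient of the diagram d.  This weight is
   invariant under an orthogonal change of labels at every vertex: the weight factors over the
   components of d, an isolated vertex contributes the functional "coordinate at v_0", which
   the group fixes, and an edge contributes the symmetric bilinear form with orthonormal basis
   v_0, ..., v_n, which the group preserves.  Moving the factors that belong to the top row to
   the other side by orthogonality of the k-fold tensor power turns invariance of the weight into
   commutation of the two operators. *)
theory Submission
  imports Defs "Jordan_Normal_Form.Determinant"
begin

section \<open>Weights of matchings under an orthogonal change of labels\<close>

lemma sum_PiE_insert:
  assumes "x \<notin> S"
  shows "sum F (PiE (insert x S) T) = (\<Sum>a\<in>T x. \<Sum>f\<in>PiE S T. F (f(x := a)))"
proof -
  have "sum F (PiE (insert x S) T) = (\<Sum>p\<in>T x \<times> PiE S T. F ((\<lambda>(a, f). f(x := a)) p))"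
    unfolding PiE_insert_eq using inj_combinator[OF assms, of T]
    by (subst sum.reindex) (auto simp: o_def)
  also have "\<dots> = (\<Sum>a\<in>T x. \<Sum>f\<in>PiE S T. F (f(x := a)))"
    by (simp add: sum.cartesian_product split_def)
  finally show ?thesis .
qed

text \<open>Stated for an arbitrary vertex set \<open>S\<close> in place of
  \<open>vertices k\<close>, so that an induction over the edges can delete the two endpoints of an
  edge from \<open>S\<close>.\<close>

definition matching_weight :: "'v set \<Rightarrow> 'v set set \<Rightarrow> ('v \<Rightarrow> nat) \<Rightarrow> complex" where
  "matching_weight S d f =
     (\<Prod>v\<in>S - \<Union>d. if f v = 0 then 1 else 0) *
     (\<Prod>e\<in>d. if \<forall>u\<in>e. \<forall>v\<in>e. f u = f v then 1 else 0)"

lemma matching_weight_cong: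
  assumes "\<Union>d \<subseteq> S" "\<And>v. v \<in> S \<Longrightarrow> f v = g v"
  shows "matching_weight S d f = matching_weight S d g"
proof -
  have "(\<forall>u\<in>e. \<forall>v\<in>e. f u = f v) \<longleftrightarrow> (\<forall>u\<in>e. \<forall>v\<in>e. g u = g v)" if "e \<in> d" for e
    using that assms by (metis Union_upper subsetD)
  then show ?thesis
    unfolding matching_weight_def using assms(2)
    by (intro arg_cong2[where f = "(*)"] prod.cong) auto
qed

text \<open>The endpoints of the new edge are not isolated, so deleting them from \<open>S\<close>
  leaves the same isolated vertices and only the factor of the new edge splits off.\<close>

lemma matching_weight_insert:
  assumes "finite d" "{u, v} \<notin> d"
  shows "matching_weight S (insert {u, v} d) f =
    (if f u = f v then 1 else 0) * matching_weight (S - {u, v}) d f"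
proof -
  have "S - \<Union>(insert {u, v} d) = S - {u, v} - \<Union>d" by auto
  then show ?thesis
    using assms unfolding matching_weight_def by auto
qed

text \<open>Induction over the edges, with \<open>S\<close> varying. Without edges the sum factors
  over the vertices, and only the label 0 survives at each of them. An edge \<open>{u, v}\<close>
  forces a common label \<open>a\<close> at \<open>u\<close> and \<open>v\<close>, and summing over
  \<open>a\<close> gives the inner product of the columns \<open>h u\<close> and \<open>h v\<close>
  of \<open>G\<close>.\<close>

lemma matching_weight_invariant:
  fixes G :: "nat \<Rightarrow> nat \<Rightarrow> complex"
  assumes fixes0: "\<And>c. c \<in> {0..n} \<Longrightarrow> G 0 c = (if c = 0 then 1 else 0)"
    and columns: "\<And>b c. b \<in> {0..n} \<Longrightarrow> c \<in> {0..n} \<Longrightarrow>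
      (\<Sum>a\<in>{0..n}. G a b * G a c) = (if b = c then 1 else 0)"
    and "finite d" "finite S" "\<And>e. e \<in> d \<Longrightarrow> \<exists>u\<in>S. \<exists>v\<in>S. u \<noteq> v \<and> e = {u, v}"
    and "disjoint d" "\<And>v. v \<in> S \<Longrightarrow> h v \<in> {0..n}"
  shows "(\<Sum>f\<in>PiE S (\<lambda>_. {0..n}). matching_weight S d f * (\<Prod>v\<in>S. G (f v) (h v))) =
    matching_weight S d h"
  using assms(3-)
proof (induction d arbitrary: S rule: finite_induct)
  case empty
  have "(\<Sum>f\<in>PiE S (\<lambda>_. {0..n}). matching_weight S {} f * (\<Prod>v\<in>S. G (f v) (h v))) =
    (\<Sum>f\<in>PiE S (\<lambda>_. {0..n}). \<Prod>v\<in>S. (if f v = 0 then 1 else 0) * G (f v) (h v))"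
    by (simp add: matching_weight_def prod.distrib)
  also have "\<dots> = (\<Prod>v\<in>S. \<Sum>a\<in>{0..n}. (if a = 0 then 1 else 0) * G a (h v))"
    using empty by (subst prod_sum_PiE) auto
  also have "\<dots> = (\<Prod>v\<in>S. G 0 (h v))"
    by (intro prod.cong) (simp_all add: if_distrib[of "\<lambda>x. x * _"] cong: if_cong)
  also have "\<dots> = matching_weight S {} h"
    unfolding matching_weight_def using empty fixes0 by (auto intro!: prod.cong)
  finally show ?case .
next
  case (insert e d)
  obtain u v where uv: "u \<in> S" "v \<in> S" "u \<noteq> v" "e = {u, v}"
    using insert.prems(2)[of e] by auto
  define S' where "S' = S - {u, v}"
  have S: "S = insert u (insert v S')" and nin: "u \<notin> insert v S'" "v \<notin> S'"
    using uv by (auto simp: S'_def)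
  have fin: "finite S'" using insert.prems(1) by (simp add: S'_def)
  \<comment> \<open>Disjointness keeps the remaining edges away from \<open>u\<close> and
    \<open>v\<close>, so they form a matching on \<open>S'\<close>.\<close>
  have edges: "\<exists>x\<in>S'. \<exists>y\<in>S'. x \<noteq> y \<and> e' = {x, y}" if "e' \<in> d" for e'
  proof -
    have "e' \<inter> e = {}"
      using insert.prems(3) insert.hyps(2) that by (auto simp: disjoint_def pairwise_def disjnt_def)
    moreover obtain x y where "x \<in> S" "y \<in> S" "x \<noteq> y" "e' = {x, y}"
      using insert.prems(2)[of e'] \<open>e' \<in> d\<close> by auto
    ultimately show ?thesis using uv by (auto simp: S'_def)
  qed
  have sub: "\<Union>d \<subseteq> S'" using edges by blast
  have h: "h u \<in> {0..n}" "h v \<in> {0..n}" using insert.prems(4) uv by auto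
  have w: "matching_weight S (insert e d) f = (if f u = f v then 1 else 0) * matching_weight S' d f"
    for f unfolding uv(4) S'_def using insert.hyps uv(4) by (intro matching_weight_insert) auto
  let ?W = "\<lambda>f. matching_weight S' d f * (\<Prod>x\<in>S'. G (f x) (h x))"
  \<comment> \<open>A labelling of \<open>S\<close> consists of a labelling \<open>f\<close> of
    \<open>S'\<close> and the values \<open>a\<close> at \<open>u\<close> and \<open>b\<close> at
    \<open>v\<close>. The updates are nested the way \<open>sum_PiE_insert\<close> produces them
    when it peels off \<open>u\<close> first and then \<open>v\<close>.\<close>
  have upd: "matching_weight S (insert e d) (f(v := b, u := a)) *
        (\<Prod>x\<in>S. G ((f(v := b, u := a)) x) (h x)) =
      (if a = b then G a (h u) * G b (h v) else 0) * ?W f" for f a b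
  proof -
    have "matching_weight S' d (f(v := b, u := a)) = matching_weight S' d f"
      using sub nin by (intro matching_weight_cong) auto
    moreover have "(\<Prod>x\<in>S'. G ((f(v := b, u := a)) x) (h x)) = (\<Prod>x\<in>S'. G (f x) (h x))"
      using nin by (intro prod.cong) auto
    moreover have "(\<Prod>x\<in>S. G ((f(v := b, u := a)) x) (h x)) =
        G a (h u) * G b (h v) * (\<Prod>x\<in>S'. G ((f(v := b, u := a)) x) (h x))"
      unfolding S using nin fin uv(3)[symmetric] by (simp add: mult.assoc)
    ultimately show ?thesis using uv(3) unfolding w by simp
  qed
  have "(\<Sum>f\<in>PiE S (\<lambda>_. {0..n}).
        matching_weight S (insert e d) f * (\<Prod>x\<in>S. G (f x) (h x))) =
      (\<Sum>a\<in>{0..n}. \<Sum>b\<in>{0..n}. \<Sum>f\<in>PiE S' (\<lambda>_. {0..n}).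
        (if a = b then G a (h u) * G b (h v) else 0) * ?W f)"
    unfolding upd[symmetric]
    by (subst (1) S, subst sum_PiE_insert[OF nin(1)], subst sum_PiE_insert[OF nin(2)]) (rule refl)
  \<comment> \<open>\<open>?W f\<close> does not involve \<open>a\<close> and \<open>b\<close>, so
    the contribution of the edge separates from that of \<open>S'\<close>.\<close>
  also have "\<dots> = (\<Sum>a\<in>{0..n}. \<Sum>b\<in>{0..n}. if a = b then G a (h u) * G b (h v) else 0) *
      (\<Sum>f\<in>PiE S' (\<lambda>_. {0..n}). ?W f)"
    by (simp only: sum_distrib_right flip: sum_distrib_left)
  also have "(\<Sum>a\<in>{0..n}. \<Sum>b\<in>{0..n}. if a = b then G a (h u) * G b (h v) else 0) =
      (if h u = h v then 1 else 0)"
    using columns[OF h] by (simp del: atLeastAtMost_iff cong: sum.cong)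
  also have "(\<Sum>f\<in>PiE S' (\<lambda>_. {0..n}). ?W f) = matching_weight S' d h"
    using insert.prems fin edges
    by (intro insert.IH) (auto simp: S'_def intro: pairwise_subset)
  finally show ?case unfolding w .
qed

section \<open>Words and labellings as functions\<close>

lemma finite_words: "finite (words n k)"
  unfolding words_def using finite_lists_length_eq[of "{0..n}" k] by (simp add: conj_commute)

lemma nth_words: "w \<in> words n k \<Longrightarrow> m < k \<Longrightarrow> w ! m \<in> {0..n}"
  unfolding words_def by (auto dest: nth_mem)

lemma words_eqI: "v \<in> words n k \<Longrightarrow> w \<in> words n k \<Longrightarrow> (\<And>m. m < k \<Longrightarrow> v ! m = w ! m) \<Longrightarrow> v = w"
  unfolding words_def by (auto intro: nth_equalityI)

lemma map_upt_words: "(\<And>m. m < k \<Longrightarrow> f m \<in> {0..n}) \<Longrightarrow> map f [0..<k] \<in> words n k"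
  unfolding words_def by auto

text \<open>The distributive law \<open>prod_sum_PiE\<close>, transported along the bijection
  between words and functions on the \<open>k\<close> positions.\<close>

lemma sum_words_prod:
  fixes F :: "nat \<Rightarrow> nat \<Rightarrow> complex"
  shows "(\<Sum>j\<in>words n k. \<Prod>m<k. F m (j ! m)) = (\<Prod>m<k. \<Sum>a\<in>{0..n}. F m a)"
proof -
  have "(\<Sum>j\<in>words n k. \<Prod>m<k. F m (j ! m)) = (\<Sum>f\<in>PiE {..<k} (\<lambda>_. {0..n}). \<Prod>m<k. F m (f m))"
  proof (rule sum.reindex_bij_witness[where i = "\<lambda>f. map f [0..<k]"
        and j = "\<lambda>w. \<lambda>m\<in>{..<k}. w ! m"])
    fix w assume w: "w \<in> words n k"
    show "(\<lambda>m\<in>{..<k}. w ! m) \<in> PiE {..<k} (\<lambda>_. {0..n})"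
      using nth_words[OF w] by auto
    show "map (\<lambda>m\<in>{..<k}. w ! m) [0..<k] = w"
      using w by (auto simp: words_def intro!: nth_equalityI)
  next
    fix f assume f: "f \<in> PiE {..<k} (\<lambda>_. {0..n})"
    show "map f [0..<k] \<in> words n k"
      using f by (intro map_upt_words PiE_mem[OF f]) simp
    show "(\<lambda>m\<in>{..<k}. map f [0..<k] ! m) = f"
      using f by (intro ext) (simp add: PiE_arb[OF f] restrict_def)
  qed auto
  then show ?thesis by (simp add: prod_sum_PiE)
qed

lemma finite_vertices: "finite (vertices k)"
  by (simp add: vertices_def)

lemma prod_vertices:
  "(\<Prod>v\<in>vertices k. F v) = (\<Prod>m<k. F (Bot m)) * (\<Prod>m<k. F (Top m))"
  unfolding vertices_def
  by (subst prod.union_disjoint) (auto simp: prod.reindex inj_on_def mult.commute)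

text \<open>Two words amount to one labelling of the \<open>2k\<close> vertices. The assumption on
  \<open>F\<close> reconciles two conventions off the vertices: there
  \<open>vertex_label a b\<close> is an out-of-range list access, while a function in
  \<open>PiE\<close> is \<open>undefined\<close>.\<close>

lemma sum_words_vertices:
  fixes F :: "(vertex \<Rightarrow> nat) \<Rightarrow> complex"
  assumes "\<And>f g. (\<And>v. v \<in> vertices k \<Longrightarrow> f v = g v) \<Longrightarrow> F f = F g"
  shows "(\<Sum>a\<in>words n k. \<Sum>b\<in>words n k. F (vertex_label a b)) =
    (\<Sum>f\<in>PiE (vertices k) (\<lambda>_. {0..n}). F f)"
  unfolding sum.cartesian_product
proof (rule sum.reindex_bij_witness[
      where i = "\<lambda>f. (map (\<lambda>m. f (Bot m)) [0..<k], map (\<lambda>m. f (Top m)) [0..<k])"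
        and j = "\<lambda>(a, b). restrict (vertex_label a b) (vertices k)"], goal_cases)
  case (1 p)
  then show ?case by (auto simp: words_def vertices_def intro!: nth_equalityI)
next
  case (2 p)
  then have "vertex_label (fst p) (snd p) v \<in> {0..n}" if "v \<in> vertices k" for v
    using that nth_words[of "fst p" n k] nth_words[of "snd p" n k]
    by (auto simp: vertices_def simp del: atLeastAtMost_iff)
  then show ?case by (simp add: case_prod_beta restrict_PiE_iff)
next
  case (3 f)
  show ?case
  proof
    fix v
    show "(case (map (\<lambda>m. f (Bot m)) [0..<k], map (\<lambda>m. f (Top m)) [0..<k]) of
        (a, b) \<Rightarrow> restrict (vertex_label a b) (vertices k)) v = f v"
      using PiE_arb[OF 3, of v] by (cases v) (auto simp: vertices_def)
  qed
next
  case (4 f)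
  show ?case
    by (intro SigmaI map_upt_words PiE_mem[OF 4]) (simp_all add: vertices_def)
next
  case (5 p)
  then show ?case by (auto intro: assms)
qed

section \<open>Diagrams as matchings\<close>

lemma rb_weight_eq: "rb_weight k d i j = matching_weight (vertices k) d (vertex_label i j)"
proof -
  have "{v \<in> vertices k. \<forall>e\<in>d. v \<notin> e} = vertices k - \<Union>d" by auto
  then show ?thesis by (simp add: rb_weight_def matching_weight_def)
qed

text \<open>Two edges that meet in \<open>x\<close> can be written \<open>{x, y}\<close> and
  \<open>{x, y'}\<close>, and uniqueness of the neighbour of \<open>x\<close> forces
  \<open>y = y'\<close>.\<close>

lemma rb_diagrams_disjoint:
  assumes "d \<in> rb_diagrams k"
  shows "disjoint d"
proof -
  have "e = e'" if "e \<in> d" "e' \<in> d" "x \<in> e" "x \<in> e'" for e e' x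
  proof -
    have edge: "\<exists>y. e = {x, y} \<and> x \<in> vertices k" if "e \<in> d" "x \<in> e" for e
      using assms that unfolding rb_diagrams_def by (fastforce simp: insert_commute)
    obtain y where "e = {x, y}" "x \<in> vertices k"
      using edge[of e] \<open>e \<in> d\<close> \<open>x \<in> e\<close> by blast
    moreover obtain y' where "e' = {x, y'}"
      using edge[of e'] \<open>e' \<in> d\<close> \<open>x \<in> e'\<close> by blast
    moreover have "\<exists>\<^sub>\<le>\<^sub>1v. {x, v} \<in> d"
      using assms \<open>x \<in> vertices k\<close> unfolding rb_diagrams_def by blast
    ultimately show ?thesis using that by (auto dest: Uniq_D)
  qed
  then show ?thesis by (auto simp: disjoint_def pairwise_def disjnt_def)
qed

lemma rb_diagrams_edge:
  "d \<in> rb_diagrams k \<Longrightarrow> e \<in> d \<Longrightarrow> \<exists>u\<in>vertices k. \<exists>v\<in>vertices k. u \<noteq> v \<and> e = {u, v}"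
  unfolding rb_diagrams_def by blast

lemma rb_diagrams_subset: "d \<in> rb_diagrams k \<Longrightarrow> \<Union>d \<subseteq> vertices k"
  using rb_diagrams_edge by fastforce

lemma finite_rb_diagram: "d \<in> rb_diagrams k \<Longrightarrow> finite d"
  using rb_diagrams_subset finite_vertices by (meson finite_UnionD finite_subset)

section \<open>The orthogonal group on V and on its tensor powers\<close>

lemma act_basis_0:
  "a \<le> n \<Longrightarrow> act_basis n g a 0 = (if a = 0 then 1 else 0)"
  by (auto simp: act_basis_def basis_vec_def)

lemma act_basis_col_0: "act_basis n g 0 a = (if a = 0 then 1 else 0)"
  by (auto simp: act_basis_def basis_vec_def)

lemma act_basis_Suc: "a < n \<Longrightarrow> act_basis n g (Suc b) (Suc a) = g $$ (a, b)"
  by (auto simp: act_basis_def basis_vec_def if_distrib[of "\<lambda>x. _ * x"] cong: if_cong)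

lemma act_basis_outside: "a > n \<Longrightarrow> act_basis n g b a = 0"
  by (auto simp: act_basis_def basis_vec_def)

text \<open>For square matrices a right inverse is also a left inverse. This order of the factors
  gives orthonormal columns, the given order orthonormal rows.\<close>

lemma orthogonal_group_transpose:
  assumes "g \<in> orthogonal_group n"
  shows "transpose_mat g * g = 1\<^sub>m n"
  using assms mat_mult_left_right_inverse[of g n "transpose_mat g"]
  by (auto simp: orthogonal_group_def)

lemma sum_atLeast0_Suc:
  fixes f :: "nat \<Rightarrow> 'a::comm_monoid_add"
  shows "(\<Sum>a\<in>{0..n}. f a) = f 0 + (\<Sum>a<n. f (Suc a))"
  by (simp add: atLeast0AtMost sum.atMost_shift)

text \<open>On V the element \<open>g\<close> acts by the block matrix diag(1, g), whose entry in
  row \<open>a\<close> and column \<open>b\<close> is \<open>act_basis n g b a\<close>. The block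
  \<open>g\<close> contributes an entry of \<open>transpose_mat g * g\<close>.\<close>

lemma act_basis_columns:
  assumes g: "g \<in> orthogonal_group n" and "b \<in> {0..n}" "c \<in> {0..n}"
  shows "(\<Sum>a\<in>{0..n}. act_basis n g b a * act_basis n g c a) = (if b = c then 1 else 0)"
proof (cases "b = 0 \<or> c = 0")
  case True
  then show ?thesis
    using assms(2,3) by (auto simp: sum_atLeast0_Suc act_basis_col_0 act_basis_0)
next
  case False
  \<comment> \<open>Labels from 1 to \<open>n\<close> become matrix indices from 0 to
    \<open>n - 1\<close>.\<close>
  then obtain b' c' where bc: "b = Suc b'" "c = Suc c'" "b' < n" "c' < n"
    using assms(2,3) by (auto simp: gr0_conv_Suc)
  have car: "g \<in> carrier_mat n n" using g by (simp add: orthogonal_group_def)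
  have "(transpose_mat g * g) $$ (b', c') = (\<Sum>a<n. g $$ (a, b') * g $$ (a, c'))"
    using bc car by (auto simp: scalar_prod_def atLeast0LessThan)
  then show ?thesis
    using bc orthogonal_group_transpose[OF g]
    by (simp add: sum_atLeast0_Suc act_basis_Suc act_basis_0)
qed

text \<open>The same block argument with \<open>g * transpose_mat g\<close>; the sum now runs over
  the columns, the first index of \<open>act_basis\<close>.\<close>

lemma act_basis_rows:
  assumes g: "g \<in> orthogonal_group n" and "b \<in> {0..n}" "c \<in> {0..n}"
  shows "(\<Sum>a\<in>{0..n}. act_basis n g a b * act_basis n g a c) = (if b = c then 1 else 0)"
proof (cases "b = 0 \<or> c = 0")
  case True
  then show ?thesis
    using assms(2,3) by (auto simp: sum_atLeast0_Suc act_basis_col_0 act_basis_0)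
next
  case False
  then obtain b' c' where bc: "b = Suc b'" "c = Suc c'" "b' < n" "c' < n"
    using assms(2,3) by (auto simp: gr0_conv_Suc)
  have car: "g \<in> carrier_mat n n" and inv: "g * transpose_mat g = 1\<^sub>m n"
    using g by (auto simp: orthogonal_group_def)
  have "(g * transpose_mat g) $$ (b', c') = (\<Sum>a<n. g $$ (b', a) * g $$ (c', a))"
    using bc car by (auto simp: scalar_prod_def atLeast0LessThan)
  then show ?thesis
    using bc inv by (simp add: sum_atLeast0_Suc act_basis_Suc act_basis_col_0)
qed

text \<open>The entry of the \<open>k\<close>-fold tensor power of diag(1, g) in column
  \<open>i\<close> and row \<open>w\<close>; the source word comes first, as in
  \<open>act_basis\<close>.\<close>

definition rho_entry :: "nat \<Rightarrow> nat \<Rightarrow> complex mat \<Rightarrow> nat list \<Rightarrow> nat list \<Rightarrow> complex" where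
  "rho_entry n k g i w = (\<Prod>m<k. act_basis n g (i ! m) (w ! m))"

text \<open>The sum over words factors over the positions, which leaves the orthonormality of the
  rows on V at each position.\<close>

lemma rho_entry_rows:
  assumes "g \<in> orthogonal_group n" "b \<in> words n k" "c \<in> words n k"
  shows "(\<Sum>j\<in>words n k. rho_entry n k g j b * rho_entry n k g j c) = (if b = c then 1 else 0)"
proof -
  have "(\<Sum>j\<in>words n k. rho_entry n k g j b * rho_entry n k g j c) =
      (\<Prod>m<k. \<Sum>a\<in>{0..n}. act_basis n g a (b ! m) * act_basis n g a (c ! m))"
    by (simp add: rho_entry_def flip: prod.distrib sum_words_prod)
  also have "\<dots> = (\<Prod>m<k. if b ! m = c ! m then 1 else 0)"
    using assms by (intro prod.cong refl act_basis_rows nth_words)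
      (auto dest: nth_words)
  \<comment> \<open>Distinct words differ at some position, and the factor there is 0.\<close>
  also have "\<dots> = (if b = c then 1 else 0)"
    using words_eqI[OF assms(2,3)] by (auto intro!: prod_zero)
  finally show ?thesis .
qed

section \<open>Invariance of diagram weights and intertwining\<close>

lemma rb_weight_invariant:
  assumes g: "g \<in> orthogonal_group n" and d: "d \<in> rb_diagrams k"
    and i: "i \<in> words n k" and j: "j \<in> words n k"
  shows "(\<Sum>a\<in>words n k. \<Sum>b\<in>words n k.
      rb_weight k d a b * (rho_entry n k g i a * rho_entry n k g j b)) = rb_weight k d i j"
proof -
  let ?F = "\<lambda>f. matching_weight (vertices k) d f *
    (\<Prod>v\<in>vertices k. act_basis n g (vertex_label i j v) (f v))"
  have "(\<Sum>a\<in>words n k. \<Sum>b\<in>words n k.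
      rb_weight k d a b * (rho_entry n k g i a * rho_entry n k g j b)) =
    (\<Sum>a\<in>words n k. \<Sum>b\<in>words n k. ?F (vertex_label a b))"
    by (simp add: rb_weight_eq prod_vertices rho_entry_def)
  also have "\<dots> = (\<Sum>f\<in>PiE (vertices k) (\<lambda>_. {0..n}). ?F f)"
  proof (rule sum_words_vertices)
    fix f f' :: "vertex \<Rightarrow> nat"
    assume "\<And>v. v \<in> vertices k \<Longrightarrow> f v = f' v"
    then show "?F f = ?F f'"
      using matching_weight_cong[OF rb_diagrams_subset[OF d], of f f'] by simp
  qed
  \<comment> \<open>\<open>G\<close> takes the row first and the column second, the reverse of
    \<open>act_basis\<close>. Its row 0 holds the coordinates at \<open>v_0\<close> of the vectors
    \<open>g v_c\<close>.\<close>
  also have "\<dots> = matching_weight (vertices k) d (vertex_label i j)"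
    using act_basis_col_0 act_basis_columns[OF g] finite_rb_diagram[OF d] finite_vertices
      rb_diagrams_edge[OF d] rb_diagrams_disjoint[OF d] nth_words[OF i] nth_words[OF j]
    by (intro matching_weight_invariant[where G = "\<lambda>a c. act_basis n g c a"])
      (auto simp: vertices_def act_basis_0)
  finally show ?thesis by (simp add: rb_weight_eq)
qed

text \<open>Read as matrices with the source index first, invariance says R W R^t = W. Multiplying
  by R on the right and cancelling R^t R = I by \<open>rho_entry_rows\<close> gives R W = W
  R.\<close>

lemma rb_weight_intertwines:
  assumes g: "g \<in> orthogonal_group n" and d: "d \<in> rb_diagrams k"
    and i: "i \<in> words n k" and w: "w \<in> words n k"
  shows "(\<Sum>j\<in>words n k. rb_weight k d i j * rho_entry n k g j w) =
    (\<Sum>j\<in>words n k. rho_entry n k g i j * rb_weight k d j w)"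
proof -
  let ?R = "rho_entry n k g" and ?W = "rb_weight k d" and ?I = "words n k"
  have "(\<Sum>j\<in>?I. ?W i j * ?R j w) =
      (\<Sum>j\<in>?I. (\<Sum>a\<in>?I. \<Sum>b\<in>?I. ?W a b * (?R i a * ?R j b)) * ?R j w)"
    using rb_weight_invariant[OF g d i] by simp
  also have "\<dots> = (\<Sum>j\<in>?I. \<Sum>a\<in>?I. \<Sum>b\<in>?I. ?W a b * ?R i a * (?R j b * ?R j w))"
    by (simp only: sum_distrib_right mult.assoc)
  \<comment> \<open>The two swaps move the sum over \<open>j\<close> innermost, where it meets only
    the two factors that orthogonality contracts.\<close>
  also have "\<dots> = (\<Sum>a\<in>?I. \<Sum>j\<in>?I. \<Sum>b\<in>?I. ?W a b * ?R i a * (?R j b * ?R j w))"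
    by (rule sum.swap)
  also have "\<dots> = (\<Sum>a\<in>?I. \<Sum>b\<in>?I. \<Sum>j\<in>?I. ?W a b * ?R i a * (?R j b * ?R j w))"
    by (rule sum.cong[OF refl], rule sum.swap)
  also have "\<dots> = (\<Sum>a\<in>?I. \<Sum>b\<in>?I. ?W a b * ?R i a * (if b = w then 1 else 0))"
    using w by (simp add: rho_entry_rows[OF g] flip: sum_distrib_left)
  also have "\<dots> = (\<Sum>a\<in>?I. ?R i a * ?W a w)"
    using w by (simp add: finite_words if_distrib[of "\<lambda>x. _ * x"] cong: if_cong)
      (simp add: mult.commute)
  finally show ?thesis .
qed

section \<open>Operators on tensor space given by kernels\<close>

text \<open>A common form for both actions, reducing commutation to an identity of matrix entries.
  The value 0 off the words keeps the image in the tensor space.\<close>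

definition kernel_op ::
    "nat \<Rightarrow> nat \<Rightarrow> (nat list \<Rightarrow> nat list \<Rightarrow> complex) \<Rightarrow> (nat list \<Rightarrow> complex) \<Rightarrow> (nat list \<Rightarrow> complex)"
  where "kernel_op n k K = (\<lambda>t\<in>tensor_space n k. (\<lambda>w. if w \<in> words n k
     then \<Sum>i\<in>words n k. t i * K i w else 0))"

lemma kernel_op_in_tensor_End: "kernel_op n k K \<in> tensor_End n k"
  unfolding tensor_End_def
proof (intro CollectI conjI ballI allI)
  show "kernel_op n k K \<in> tensor_space n k \<rightarrow>\<^sub>E tensor_space n k"
    by (auto simp: kernel_op_def tensor_space_def)
next
  fix s t assume "s \<in> tensor_space n k" "t \<in> tensor_space n k"
  moreover from this have "(\<lambda>w. s w + t w) \<in> tensor_space n k"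
    by (simp add: tensor_space_def)
  ultimately show "kernel_op n k K (\<lambda>w. s w + t w) = (\<lambda>w. kernel_op n k K s w + kernel_op n k K t w)"
    by (auto simp: kernel_op_def sum.distrib distrib_right)
next
  fix c t assume "t \<in> tensor_space n k"
  moreover from this have "(\<lambda>w. c * t w) \<in> tensor_space n k"
    by (simp add: tensor_space_def)
  ultimately show "kernel_op n k K (\<lambda>w. c * t w) = (\<lambda>w. c * kernel_op n k K t w)"
    by (auto simp: kernel_op_def sum_distrib_left mult.assoc)
qed

lemma kernel_op_cong:
  assumes "\<And>i w. i \<in> words n k \<Longrightarrow> w \<in> words n k \<Longrightarrow> K i w = L i w"
  shows "kernel_op n k K = kernel_op n k L"
  unfolding kernel_op_def using assms by (intro restrict_ext ext) auto

text \<open>This is the matrix product; the kernel of the operator applied first stands on the left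
  because kernels take the source index first.\<close>

lemma compose_kernel_op:
  "compose (tensor_space n k) (kernel_op n k K) (kernel_op n k L) =
    kernel_op n k (\<lambda>i w. \<Sum>j\<in>words n k. L i j * K j w)"
  unfolding compose_def kernel_op_def[of n k "\<lambda>i w. \<Sum>j\<in>words n k. L i j * K j w"]
proof (intro restrict_ext ext)
  fix t w assume t: "t \<in> tensor_space n k"
  \<comment> \<open>The outer operator is extensional, so it can be evaluated only once its argument
    is known to lie in the tensor space.\<close>
  then have L: "kernel_op n k L t \<in> tensor_space n k"
    using kernel_op_in_tensor_End[of n k L] by (auto simp: tensor_End_def)
  have "(\<Sum>j\<in>words n k. (\<Sum>i\<in>words n k. t i * L i j) * K j w) =
      (\<Sum>i\<in>words n k. t i * (\<Sum>j\<in>words n k. L i j * K j w))"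
    by (simp add: sum_distrib_left sum_distrib_right mult.assoc) (rule sum.swap)
  then show "kernel_op n k K (kernel_op n k L t) w =
      (if w \<in> words n k then \<Sum>i\<in>words n k. t i * (\<Sum>j\<in>words n k. L i j * K j w) else 0)"
    using t L by (simp add: kernel_op_def)
qed

lemma pure_tensor_act_basis:
  assumes "i \<in> words n k"
  shows "pure_tensor (map (act_basis n g) i) w = (if w \<in> words n k then rho_entry n k g i w else 0)"
proof -
  have len: "length i = k" using assms by (simp add: words_def)
  show ?thesis
  proof (cases "w \<in> words n k")
    case True
    then show ?thesis using len by (auto simp: pure_tensor_def rho_entry_def words_def)
  next
    case False
    show ?thesis
    proof (cases "length w = k")
      case True
      \<comment> \<open>A word of the right length that is not in \<open>words n k\<close> has a
        letter above \<open>n\<close>, and no vector \<open>g v_b\<close> has a coordinate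
        there.\<close>
      then obtain m where "m < k" "w ! m > n"
        using False by (auto simp: words_def subset_iff in_set_conv_nth not_le)
      then have "(\<Prod>m<k. (map (act_basis n g) i ! m) (w ! m)) = 0"
        using len act_basis_outside by (intro prod_zero bexI[of _ m]) auto
      then show ?thesis using False len by (simp add: pure_tensor_def)
    qed (use False len in \<open>simp add: pure_tensor_def\<close>)
  qed
qed

lemma pure_tensor_basis_vec:
  "pure_tensor (map basis_vec j) w = (if j = w then 1 else 0)"
proof (cases "length j = length w")
  case True
  have "(\<Prod>m<length j. (map basis_vec j ! m) (w ! m)) = (\<Prod>m<length j. if j ! m = w ! m then 1 else 0)"
    by (intro prod.cong) (auto simp: basis_vec_def)
  also have "\<dots> = (if j = w then 1 else 0)"
    using True by (auto simp: list_eq_iff_nth_eq intro!: prod_zero)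
  finally show ?thesis using True by (simp add: pure_tensor_def)
qed (auto simp: pure_tensor_def)

lemma tensor_rho_kernel_op: "tensor_rho n k g = kernel_op n k (rho_entry n k g)"
  unfolding tensor_rho_def kernel_op_def
  by (intro restrict_ext ext) (auto simp: pure_tensor_act_basis intro!: sum.cong sum.neutral)

lemma rb_pi_kernel_op:
  "rb_pi n k a = kernel_op n k (\<lambda>i w. \<Sum>d\<in>rb_diagrams k. a d * rb_weight k d i w)"
  unfolding rb_pi_def kernel_op_def
proof (intro restrict_ext ext)
  fix t w
  \<comment> \<open>Only \<open>j = w\<close> contributes, and it occurs among the summands exactly
    when \<open>w\<close> is a word.\<close>
  have "(\<Sum>j\<in>words n k. rb_weight k d i j * pure_tensor (map basis_vec j) w) =
      (if w \<in> words n k then rb_weight k d i w else 0)" for d i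
    by (simp add: pure_tensor_basis_vec finite_words if_distrib[of "\<lambda>x. _ * x"] cong: if_cong)
  moreover have "(\<Sum>d\<in>rb_diagrams k. a d * (\<Sum>i\<in>words n k. t i * rb_weight k d i w)) =
      (\<Sum>i\<in>words n k. t i * (\<Sum>d\<in>rb_diagrams k. a d * rb_weight k d i w))"
    by (simp add: sum_distrib_left mult.left_commute) (rule sum.swap)
  ultimately show "(\<Sum>d\<in>rb_diagrams k. a d * (\<Sum>i\<in>words n k. t i *
       (\<Sum>j\<in>words n k. rb_weight k d i j * pure_tensor (map basis_vec j) w))) =
     (if w \<in> words n k
      then \<Sum>i\<in>words n k. t i * (\<Sum>d\<in>rb_diagrams k. a d * rb_weight k d i w) else 0)"
    by simp
qed

text \<open>Both kernels are linear in \<open>a\<close>, so exchanging the sums over words and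
  diagrams reduces the claim to a single diagram, which is
  \<open>rb_weight_intertwines\<close>.\<close>

lemma rb_pi_tensor_rho_commute:
  assumes g: "g \<in> orthogonal_group n"
  shows "compose (tensor_space n k) (rb_pi n k a) (tensor_rho n k g) =
    compose (tensor_space n k) (tensor_rho n k g) (rb_pi n k a)"
  unfolding rb_pi_kernel_op tensor_rho_kernel_op compose_kernel_op
proof (rule kernel_op_cong)
  fix i w assume iw: "i \<in> words n k" "w \<in> words n k"
  have "(\<Sum>j\<in>words n k. rho_entry n k g i j * (\<Sum>d\<in>rb_diagrams k. a d * rb_weight k d j w)) =
      (\<Sum>d\<in>rb_diagrams k. a d * (\<Sum>j\<in>words n k. rho_entry n k g i j * rb_weight k d j w))"
    by (simp add: sum_distrib_left mult.left_commute) (rule sum.swap)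
  also have "\<dots> =
      (\<Sum>d\<in>rb_diagrams k. a d * (\<Sum>j\<in>words n k. rb_weight k d i j * rho_entry n k g j w))"
    using rb_weight_intertwines[OF g _ iw] by simp
  also have "\<dots> =
      (\<Sum>j\<in>words n k. (\<Sum>d\<in>rb_diagrams k. a d * rb_weight k d i j) * rho_entry n k g j w)"
    by (simp add: sum_distrib_left sum_distrib_right mult.assoc) (rule sum.swap)
  finally show "(\<Sum>j\<in>words n k. rho_entry n k g i j * (\<Sum>d\<in>rb_diagrams k. a d * rb_weight k d j w)) =
      (\<Sum>j\<in>words n k. (\<Sum>d\<in>rb_diagrams k. a d * rb_weight k d i j) * rho_entry n k g j w)" .
qed

theorem theorem3p16:
  fixes k n :: nat
  assumes "n \<ge> 1"
  shows "(\<forall>a\<in>carrier (RB k (of_nat (n + 1))). \<forall>g\<in>orthogonal_group n.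
            compose (tensor_space n k) (rb_pi n k a) (tensor_rho n k g) =
            compose (tensor_space n k) (tensor_rho n k g) (rb_pi n k a)) \<and>
         rb_pi n k ` carrier (RB k (of_nat (n + 1))) \<subseteq> End_O n k \<and>
         tensor_rho n k ` orthogonal_group n \<subseteq> End_RB n k"
proof -
  \<comment> \<open>Both centralizers consist of linear endomorphisms; the kernel form supplies
    linearity, and commutation supplies the rest.\<close>
  have "rb_pi n k a \<in> tensor_End n k" "tensor_rho n k g \<in> tensor_End n k" for a g
    by (simp_all add: rb_pi_kernel_op tensor_rho_kernel_op kernel_op_in_tensor_End)
  then show ?thesis
    by (auto simp: End_O_def End_RB_def rb_pi_tensor_rho_commute)
qed

end
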